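(* Suppose that $\gamma,\mu\in\Delta^+_l$ and $\gamma\succcurlyeq\mu$. Then there is a unique element $w=w_{\gamma,\mu}\in W$ of minimal length such that $w_{\gamma,\mu}(\gamma)=\mu$. In this case, $\ell(w_{\gamma,\mu})=(\rho,\gamma^\vee)-(\rho,\mu^\vee)$.
   Context: $\Delta$ is an irreducible crystallographic root system in a Euclidean space with positive roots $\Delta^+$, simple roots $\Pi$, Weyl group $W$, $W$-invariant scalar product $(\ ,\ )$. $\Delta^+_l$ is the set of long positive roots (if all roots have the same length, all roots are regarded as long). $\gamma^\vee=2\gamma/(\gamma,\gamma)$, $\rho=\frac12\sum_{\gamma\in\Delta^+}\gamma$, and $\ell$ is the length function on $W$ with respect to the simple reflections. $\gamma\succcurlyeq\mu$ means that $\gamma-\mu$ is a linear combination of simple roots with nonnegative coefficients. "Unique element of minimal length" means that among all $w\in W$ with $w(\gamma)=\mu$ exactly one has the smallest length. *)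

theory Defs
  imports "HOL-Analysis.Analysis"
begin

definition reflection :: "'a::euclidean_space \<Rightarrow> 'a \<Rightarrow> 'a" where
  "reflection a x = x - (2 * (x \<bullet> a) / (a \<bullet> a)) *\<^sub>R a"

text \<open>Root systems are reduced and span the ambient space. The orthogonal reflections
  preserve the Euclidean inner product, which serves as the Weyl-invariant scalar product.\<close>

definition crystallographic_root_system :: "'a::euclidean_space set \<Rightarrow> bool" where
  "crystallographic_root_system \<Delta> \<longleftrightarrow>
     finite \<Delta> \<and> 0 \<notin> \<Delta> \<and> span \<Delta> = UNIV \<and>
     (\<forall>a\<in>\<Delta>. \<forall>c::real. c *\<^sub>R a \<in> \<Delta> \<longrightarrow> c = 1 \<or> c = -1) \<and>
     (\<forall>a\<in>\<Delta>. reflection a ` \<Delta> = \<Delta>) \<and>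
     (\<forall>a\<in>\<Delta>. \<forall>b\<in>\<Delta>. 2 * (b \<bullet> a) / (a \<bullet> a) \<in> \<int>)"

definition irreducible_system :: "'a::euclidean_space set \<Rightarrow> bool" where
  "irreducible_system \<Delta> \<longleftrightarrow>
     \<Delta> \<noteq> {} \<and>
     \<not> (\<exists>A B. A \<noteq> {} \<and> B \<noteq> {} \<and> A \<union> B = \<Delta> \<and> A \<inter> B = {} \<and> (\<forall>a\<in>A. \<forall>b\<in>B. a \<bullet> b = 0))"

definition simple_system :: "'a::euclidean_space set \<Rightarrow> 'a set \<Rightarrow> bool" where
  "simple_system \<Delta> S \<longleftrightarrow>
     S \<subseteq> \<Delta> \<and> independent S \<and> span S = UNIV \<and>
     (\<forall>b\<in>\<Delta>. \<exists>c :: 'a \<Rightarrow> int. b = (\<Sum>a\<in>S. of_int (c a) *\<^sub>R a) \<and>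
        ((\<forall>a\<in>S. 0 \<le> c a) \<or> (\<forall>a\<in>S. c a \<le> 0)))"

definition root_ge :: "'a::euclidean_space set \<Rightarrow> 'a \<Rightarrow> 'a \<Rightarrow> bool" where
  "root_ge S x y \<longleftrightarrow>
     (\<exists>c :: 'a \<Rightarrow> real. (\<forall>a\<in>S. 0 \<le> c a) \<and> x - y = (\<Sum>a\<in>S. c a *\<^sub>R a))"

definition positive_roots :: "'a::euclidean_space set \<Rightarrow> 'a set \<Rightarrow> 'a set" where
  "positive_roots \<Delta> S = {b \<in> \<Delta>. root_ge S b 0}"

text \<open>An irreducible root system has at most two root lengths, so the long roots are those
  of maximal length; if only one length occurs, every root is long.\<close>

definition long_positive_roots :: "'a::euclidean_space set \<Rightarrow> 'a set \<Rightarrow> 'a set" where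
  "long_positive_roots \<Delta> S = {b \<in> positive_roots \<Delta> S. \<forall>a\<in>\<Delta>. norm a \<le> norm b}"

definition coroot :: "'a::euclidean_space \<Rightarrow> 'a" where
  "coroot a = (2 / (a \<bullet> a)) *\<^sub>R a"

definition half_sum_positive :: "'a::euclidean_space set \<Rightarrow> 'a set \<Rightarrow> 'a" where
  "half_sum_positive \<Delta> S = (1 / 2) *\<^sub>R (\<Sum>b\<in>positive_roots \<Delta> S. b)"

text \<open>The group generated by the reflections in all roots. Closure under inverses is
  automatic because reflections are involutions.\<close>

inductive_set weyl_group :: "'a::euclidean_space set \<Rightarrow> ('a \<Rightarrow> 'a) set"
  for \<Delta> :: "'a set" where
  weyl_id: "id \<in> weyl_group \<Delta>"
| weyl_step: "a \<in> \<Delta> \<Longrightarrow> w \<in> weyl_group \<Delta> \<Longrightarrow> reflection a \<circ> w \<in> weyl_group \<Delta>"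

text \<open>The least number of simple reflections in an expression of \<open>w\<close>. Such expressions exist
  for Weyl group elements only; for other maps the value is unspecified.\<close>

definition weyl_length :: "'a::euclidean_space set \<Rightarrow> ('a \<Rightarrow> 'a) \<Rightarrow> nat" where
  "weyl_length S w =
     (LEAST n. \<exists>as. length as = n \<and> set as \<subseteq> S \<and> w = foldr (\<lambda>a f. reflection a \<circ> f) as id)"

end

theory Submission
  imports Defs
begin

text \<open>
  The proof measures a root \<open>\<nu>\<close> by the height \<open>h \<nu> = (\<rho>, \<nu>\<^sup>\<or>)\<close> of its coroot. Because
  \<open>(\<rho>, \<alpha>\<^sup>\<or>) = 1\<close> for simple \<open>\<alpha>\<close>, the reflection in \<open>\<alpha>\<close> lowers \<open>h \<nu>\<close> by the integer
  \<open>(\<nu>\<^sup>\<or>, \<alpha>)\<close>. For a root \<open>\<nu>\<close> of maximal length this integer is \<open>-1\<close>, \<open>0\<close> or \<open>1\<close>, unless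
  \<open>\<alpha> = \<nu>\<close> or \<open>\<alpha> = -\<nu>\<close>, when \<open>\<nu>\<close> goes to \<open>-\<nu>\<close>. In all cases \<open>\<bar>h\<bar>\<close> drops by at
  most 1, so a product of simple reflections that takes \<open>\<gamma>\<close> to \<open>\<mu>\<close> has at least
  \<open>h \<gamma> - h \<mu>\<close> factors (\<open>refl_prod_height_bound\<close>).

  This bound is attained (\<open>shortest_word_exists\<close>). If \<open>\<gamma> \<noteq> \<mu>\<close>, then
  \<open>(\<gamma>, \<gamma> - \<mu>) > 0\<close> since the two roots have the same length, so some simple \<open>\<alpha>\<close> that occurs
  in \<open>\<gamma> - \<mu>\<close> has \<open>(\<gamma>, \<alpha>) > 0\<close>. Passing to coroots, this reflection subtracts \<open>\<alpha>\<^sup>\<or>\<close> exactly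
  once from \<open>\<gamma>\<^sup>\<or>\<close>; as the coroots have integral coordinates with respect to the simple coroots,
  \<open>\<alpha>\<^sup>\<or>\<close> occurs in \<open>\<gamma>\<^sup>\<or> - \<mu>\<^sup>\<or>\<close> at least once, and the new root still dominates \<open>\<mu>\<close>. So one
  can descend step by step from \<open>\<gamma>\<close> to \<open>\<mu>\<close>.

  Conversely, a word that attains the bound lowers \<open>h\<close> by 1 at every step. Two such words define
  the same element by a diamond argument (\<open>shortest_word_unique\<close>). Let them begin by reflecting
  \<open>\<gamma>\<close> in the distinct simple roots \<open>\<alpha>\<close> and \<open>\<beta>\<close>. If \<open>(\<alpha>, \<beta>) < 0\<close>, then \<open>\<alpha> + \<beta>\<close> is a root and
  \<open>(\<gamma>\<^sup>\<or>, \<alpha> + \<beta>) = 2\<close>, which forces \<open>\<gamma> = \<alpha> + \<beta>\<close>; then nothing positive is left below \<open>\<gamma>\<close> once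
  \<open>\<alpha>\<close> and \<open>\<beta>\<close> are both removed. Hence the two reflections commute, and both descents can
  be continued to the common root \<open>s\<^sub>\<alpha> s\<^sub>\<beta> \<gamma>\<close>, which still dominates \<open>\<mu>\<close>.
\<close>

section \<open>Reflections and their products\<close>

lemma reflection_add: "reflection a (x + y) = reflection a x + reflection a y"
  by (simp add: reflection_def inner_add_left add_divide_distrib distrib_left scaleR_add_left)

lemma reflection_scaleR: "reflection a (c *\<^sub>R x) = c *\<^sub>R reflection a x"
  by (simp add: reflection_def scaleR_diff_right mult.left_commute)

lemma reflection_diff: "reflection a (x - y) = reflection a x - reflection a y"
  using reflection_add[of a x "- y"] reflection_scaleR[of a "-1" y] by simp

lemma reflection_inner: "reflection a x \<bullet> reflection a y = x \<bullet> y"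
  by (cases "a = 0")
    (simp_all add: reflection_def inner_diff_left inner_diff_right field_simps inner_commute)

lemma reflection_self: "reflection a a = - a"
  by (cases "a = 0") (simp_all add: reflection_def scaleR_2)

lemma reflection_involution [simp]: "reflection a (reflection a x) = x"
proof (cases "a = 0")
  case False
  then have "reflection a x \<bullet> a = - (x \<bullet> a)"
    by (simp add: reflection_def inner_diff_left)
  then show ?thesis
    by (subst (1) reflection_def) (simp add: reflection_def)
qed (simp add: reflection_def)

lemma reflection_norm: "norm (reflection a x) = norm x"
  by (simp add: norm_eq_sqrt_inner reflection_inner)

lemma reflection_minus_root: "reflection (- a) = reflection a"
  by (rule ext) (simp add: reflection_def)

lemma reflection_conjugate:
  "reflection (reflection a b) = reflection a \<circ> reflection b \<circ> reflection a"
proof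
  fix x
  have "x \<bullet> reflection a b = reflection a x \<bullet> b"
    using reflection_inner[of a "reflection a x" b] by simp
  then show "reflection (reflection a b) x = (reflection a \<circ> reflection b \<circ> reflection a) x"
    by (simp add: reflection_def[of b] reflection_def[of "reflection a b"]
        reflection_inner reflection_diff reflection_scaleR)
qed

lemma reflection_commute:
  assumes "a \<bullet> b = 0"
  shows "reflection a \<circ> reflection b = reflection b \<circ> reflection a"
proof
  fix x
  show "(reflection a \<circ> reflection b) x = (reflection b \<circ> reflection a) x"
    using assms by (simp add: reflection_def inner_diff_left inner_commute[of b a])
qed

definition refl_prod :: "'a::euclidean_space list \<Rightarrow> 'a \<Rightarrow> 'a" where
  "refl_prod as = foldr (\<lambda>a f. reflection a \<circ> f) as id"

lemma refl_prod_Nil [simp]: "refl_prod [] = id"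
  and refl_prod_Cons [simp]: "refl_prod (a # as) = reflection a \<circ> refl_prod as"
  by (simp_all add: refl_prod_def)

lemma refl_prod_append [simp]: "refl_prod (as @ bs) = refl_prod as \<circ> refl_prod bs"
  by (induction as) (simp_all add: comp_assoc)

section \<open>Coordinates with respect to the simple roots\<close>

locale based_root_system =
  fixes \<Delta> S :: "'a::euclidean_space set"
  assumes root_system: "crystallographic_root_system \<Delta>"
    and simple: "simple_system \<Delta> S"
begin

abbreviation coord :: "'a \<Rightarrow> 'a \<Rightarrow> real" where
  "coord x a \<equiv> representation S x a"

abbreviation Pos :: "'a set" where
  "Pos \<equiv> positive_roots \<Delta> S"

lemma finite_roots: "finite \<Delta>"
  and zero_not_root: "0 \<notin> \<Delta>"
  and root_multiple: "a \<in> \<Delta> \<Longrightarrow> c *\<^sub>R a \<in> \<Delta> \<Longrightarrow> c = 1 \<or> c = -1"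
  and cartan_int: "a \<in> \<Delta> \<Longrightarrow> b \<in> \<Delta> \<Longrightarrow> 2 * (b \<bullet> a) / (a \<bullet> a) \<in> \<int>"
  using root_system by (auto simp: crystallographic_root_system_def)

lemma reflection_root: "a \<in> \<Delta> \<Longrightarrow> b \<in> \<Delta> \<Longrightarrow> reflection a b \<in> \<Delta>"
  using root_system unfolding crystallographic_root_system_def by blast

lemma minus_root: "a \<in> \<Delta> \<Longrightarrow> - a \<in> \<Delta>"
  using reflection_root[of a a] by (simp add: reflection_self)

lemma root_inner_pos: "a \<in> \<Delta> \<Longrightarrow> a \<bullet> a > 0"
  using zero_not_root by auto

lemma simple_root: "a \<in> S \<Longrightarrow> a \<in> \<Delta>"
  and independent_S: "independent S"
  and span_S: "span S = UNIV"
  using simple by (auto simp: simple_system_def)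

lemma finite_S: "finite S"
  using finite_roots simple finite_subset by (auto simp: simple_system_def)

lemma coord_add: "coord (x + y) a = coord x a + coord y a"
  and coord_diff: "coord (x - y) a = coord x a - coord y a"
  and coord_scaleR: "coord (c *\<^sub>R x) a = c * coord x a"
  and coord_minus: "coord (- x) a = - coord x a"
  using representation_add[OF independent_S, of y x] representation_diff[OF independent_S, of y x]
    representation_scale[OF independent_S, of x c] representation_neg[OF independent_S, of x]
  by (auto simp: span_S)

lemma coord_simple: "b \<in> S \<Longrightarrow> coord b a = (if a = b then 1 else 0)"
  using representation_basis[OF independent_S, of b] by simp

lemma coord_sum:
  assumes "x = (\<Sum>b\<in>S. c b *\<^sub>R b)" "a \<in> S"
  shows "coord x a = c a"
proof -
  have "coord x a = (\<Sum>b\<in>S. coord (c b *\<^sub>R b) a)"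
    unfolding assms(1) by (subst representation_sum[OF independent_S]) (auto simp: span_S)
  also have "\<dots> = (\<Sum>b\<in>S. if a = b then c b else 0)"
    by (rule sum.cong) (auto simp: coord_scaleR coord_simple)
  also have "\<dots> = c a" using assms(2) finite_S by simp
  finally show ?thesis .
qed

lemma coord_expand: "x = (\<Sum>a\<in>S. coord x a *\<^sub>R a)"
  using sum_representation_eq[OF independent_S, of x S] finite_S by (simp add: span_S)

lemma coord_expand_inner: "x \<bullet> y = (\<Sum>a\<in>S. coord x a * (a \<bullet> y))"
  by (subst coord_expand[of x]) (simp add: inner_sum_left)

lemma inner_pos_simple:
  assumes "\<forall>a\<in>S. 0 \<le> coord x a" "0 < x \<bullet> y"
  shows "\<exists>a\<in>S. 0 < coord x a \<and> 0 < y \<bullet> a"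
proof (rule ccontr)
  assume neg: "\<not> ?thesis"
  have "coord x a * (a \<bullet> y) \<le> 0" if "a \<in> S" for a
  proof (cases "coord x a = 0")
    case False
    then have "0 < coord x a" "a \<bullet> y \<le> 0"
      using assms(1) neg that by (auto simp: order_less_le inner_commute)
    then show ?thesis by (simp add: mult_nonneg_nonpos)
  qed simp
  then have "(\<Sum>a\<in>S. coord x a * (a \<bullet> y)) \<le> 0" by (rule sum_nonpos)
  then show False using assms(2) coord_expand_inner[of x y] by simp
qed

lemma coord_reflection:
  "b \<in> S \<Longrightarrow> coord (reflection b x) a = coord x a - (if a = b then 2 * (x \<bullet> b) / (b \<bullet> b) else 0)"
  by (simp add: reflection_def coord_diff coord_scaleR coord_simple)

lemma root_ge_iff: "root_ge S x y \<longleftrightarrow> (\<forall>a\<in>S. coord y a \<le> coord x a)"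
proof
  assume "root_ge S x y"
  then obtain c where c: "\<forall>a\<in>S. 0 \<le> c a" "x - y = (\<Sum>a\<in>S. c a *\<^sub>R a)"
    by (auto simp: root_ge_def)
  show "\<forall>a\<in>S. coord y a \<le> coord x a"
    using coord_sum[OF c(2)] c(1) by (fastforce simp: coord_diff)
next
  assume "\<forall>a\<in>S. coord y a \<le> coord x a"
  then show "root_ge S x y"
    unfolding root_ge_def
    by (intro exI[of _ "coord (x - y)"]) (auto simp: coord_diff intro: coord_expand[of "x - y", simplified coord_diff])
qed

lemma coord_root_int:
  assumes "b \<in> \<Delta>" "a \<in> S"
  shows "coord b a \<in> \<int>"
  using assms simple coord_sum[of b "\<lambda>a. of_int (_ a)" a] unfolding simple_system_def
  by (metis Ints_of_int)

lemma coord_root_sign: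
  assumes "b \<in> \<Delta>"
  shows "(\<forall>a\<in>S. 0 \<le> coord b a) \<or> (\<forall>a\<in>S. coord b a \<le> 0)"
proof -
  obtain c :: "'a \<Rightarrow> int" where c: "b = (\<Sum>a\<in>S. of_int (c a) *\<^sub>R a)"
    "(\<forall>a\<in>S. 0 \<le> c a) \<or> (\<forall>a\<in>S. c a \<le> 0)"
    using assms simple unfolding simple_system_def by blast
  show ?thesis using coord_sum[OF c(1)] c(2) by auto
qed

section \<open>Positive roots\<close>

lemma Pos_iff: "b \<in> Pos \<longleftrightarrow> b \<in> \<Delta> \<and> (\<forall>a\<in>S. 0 \<le> coord b a)"
  using coord_scaleR[of 0] by (simp add: positive_roots_def root_ge_iff)

lemma Pos_root: "b \<in> Pos \<Longrightarrow> b \<in> \<Delta>"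
  by (simp add: Pos_iff)

lemma simple_Pos: "a \<in> S \<Longrightarrow> a \<in> Pos"
  by (auto simp: Pos_iff simple_root coord_simple)

lemma finite_Pos: "finite Pos"
  using finite_roots by (simp add: positive_roots_def)

lemma root_cases:
  assumes "b \<in> \<Delta>"
  obtains "b \<in> Pos" | "- b \<in> Pos"
  using coord_root_sign[OF assms] assms minus_root[OF assms] by (auto simp: Pos_iff coord_minus)

lemma Pos_if_coord_pos:
  assumes "b \<in> \<Delta>" "a \<in> S" "0 < coord b a"
  shows "b \<in> Pos"
  using coord_root_sign[OF assms(1)] assms by (force simp: Pos_iff)

text \<open>A positive root other than \<open>a\<close> involves a second simple root, and the reflection in \<open>a\<close> does
  not change that coordinate.\<close>

lemma reflection_simple_Pos:
  assumes "b \<in> Pos" "a \<in> S" "b \<noteq> a"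
  shows "reflection a b \<in> Pos"
proof -
  have "\<exists>c\<in>S. c \<noteq> a \<and> coord b c \<noteq> 0"
  proof (rule ccontr)
    assume "\<not> ?thesis"
    then have "(\<Sum>c\<in>S. coord b c *\<^sub>R c) = (\<Sum>c\<in>S. if c = a then coord b a *\<^sub>R a else 0)"
      by (intro sum.cong) auto
    then have b: "b = coord b a *\<^sub>R a"
      using coord_expand[of b] assms(2) finite_S by simp
    then have "coord b a = 1 \<or> coord b a = -1"
      using root_multiple[of a "coord b a"] simple_root assms(1,2) Pos_root by metis
    moreover have "0 \<le> coord b a" using assms by (auto simp: Pos_iff)
    ultimately show False using b assms(3) by auto
  qed
  then obtain c where c: "c \<in> S" "c \<noteq> a" "coord b c \<noteq> 0" by blast
  then have "0 < coord (reflection a b) c"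
    using assms by (auto simp: Pos_iff coord_reflection order_less_le)
  then show ?thesis
    using Pos_if_coord_pos c(1) reflection_root simple_root Pos_root assms by blast
qed

lemma simple_inner_nonpos:
  assumes "a \<in> S" "b \<in> S" "a \<noteq> b"
  shows "a \<bullet> b \<le> 0"
proof -
  have "0 \<le> coord (reflection a b) a"
    using reflection_simple_Pos[of b a] assms simple_Pos by (auto simp: Pos_iff)
  then have "2 * (b \<bullet> a) / (a \<bullet> a) \<le> 0"
    using assms by (simp add: coord_reflection coord_simple)
  then show ?thesis
    using root_inner_pos[OF simple_root[OF assms(1)]]
    by (simp add: divide_le_0_iff inner_commute)
qed

text \<open>All positive roots arise from the simple ones by simple reflections, without leaving the
  positive roots: a root that is not simple has positive product with some simple root,
  and that reflection strictly lowers its sum of coordinates.\<close>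

lemma positive_root_induct [consumes 1, case_names simple reflect]:
  assumes "b \<in> Pos"
    and base: "\<And>a. a \<in> S \<Longrightarrow> P a"
    and step: "\<And>a c. a \<in> S \<Longrightarrow> c \<in> Pos \<Longrightarrow> P c \<Longrightarrow> P (reflection a c)"
  shows "P b"
proof -
  let ?ht = "\<lambda>b. \<Sum>a\<in>S. coord b a"
  have "b \<in> Pos \<Longrightarrow> ?ht b \<le> real n \<Longrightarrow> P b" for n
    using assms(1)
  proof (induction n arbitrary: b)
    case (0 b)
    have nonneg: "\<forall>a\<in>S. 0 \<le> coord b a" using 0 by (auto simp: Pos_iff)
    have "?ht b = 0"
      using 0 sum_nonneg[of S "coord b"] nonneg by auto
    then have "\<forall>a\<in>S. coord b a = 0"
      using sum_nonneg_eq_0_iff[OF finite_S, of "coord b"] nonneg by auto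
    then have "b = 0" using coord_expand[of b] by simp
    then show ?case using 0 Pos_root zero_not_root by blast
  next
    case (Suc n b)
    show ?case
    proof (cases "b \<in> S")
      case False
      obtain a where a: "a \<in> S" "0 < b \<bullet> a"
        using inner_pos_simple[of b b] root_inner_pos[OF Pos_root[OF Suc.prems(1)]] Suc.prems(1)
        by (auto simp: Pos_iff)
      let ?k = "2 * (b \<bullet> a) / (a \<bullet> a)"
      have "?k > 0" using a root_inner_pos simple_root by simp
      moreover have "?k \<in> \<int>" using cartan_int Pos_root Suc.prems(1) simple_root a(1) by blast
      ultimately have k: "1 \<le> ?k" by (auto elim!: Ints_cases)
      have "?ht (reflection a b) = ?ht b - ?k"
        using a(1) finite_S by (simp add: coord_reflection sum_subtractf)
      then have "?ht (reflection a b) \<le> real n" using k Suc.prems by simp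
      moreover have r: "reflection a b \<in> Pos"
        using reflection_simple_Pos Suc.prems(1) a(1) False by blast
      ultimately have "P (reflection a b)" using Suc.IH by blast
      then show ?thesis using step[OF a(1) r] by simp
    qed (simp add: base)
  qed
  then show ?thesis using assms(1) real_arch_simple[of "?ht b"] by blast
qed

text \<open>The numbers here are the coordinates of the coroot of \<open>b\<close> with respect to the simple coroots;
  under the reflection in \<open>c\<close> only the coordinate at \<open>c\<close> changes, by an integer.\<close>

lemma coroot_coord_int:
  assumes "b \<in> Pos" "a \<in> S"
  shows "coord b a * (a \<bullet> a) / (b \<bullet> b) \<in> \<int>"
  using assms(1)
proof (induction rule: positive_root_induct)
  case (simple c)
  then show ?case using root_inner_pos[OF simple_root[OF simple]] by (simp add: coord_simple)
next
  case (reflect c b)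
  show ?case
  proof (cases "a = c")
    case True
    have "a \<bullet> a > 0" "b \<bullet> b > 0"
      using root_inner_pos simple_root Pos_root reflect assms by auto
    then have "coord (reflection c b) a * (a \<bullet> a) / (reflection c b \<bullet> reflection c b)
        = coord b a * (a \<bullet> a) / (b \<bullet> b) - 2 * (a \<bullet> b) / (b \<bullet> b)"
      using True assms(2) by (simp add: coord_reflection reflection_inner field_simps inner_commute)
    also have "\<dots> \<in> \<int>"
      using reflect cartan_int[of b a] Pos_root simple_root assms(2) by (intro Ints_diff) auto
    finally show ?thesis .
  next
    case False
    then show ?thesis using reflect by (simp add: coord_reflection reflection_inner)
  qed
qed

lemma reflection_eq_refl_prod:
  assumes "b \<in> \<Delta>"
  shows "\<exists>as. set as \<subseteq> S \<and> reflection b = refl_prod as"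
proof -
  have *: "\<exists>as. set as \<subseteq> S \<and> reflection b = refl_prod as" if "b \<in> Pos" for b
    using that
  proof (induction rule: positive_root_induct)
    case (simple a)
    then show ?case by (intro exI[of _ "[a]"]) simp
  next
    case (reflect a c)
    then obtain as where "set as \<subseteq> S" "reflection c = refl_prod as" by blast
    then show ?case
      using reflect(1) by (intro exI[of _ "a # as @ [a]"]) (simp add: reflection_conjugate comp_assoc)
  qed
  show ?thesis
    using assms by (rule root_cases) (use * reflection_minus_root in metis)+
qed

lemma weyl_group_iff: "w \<in> weyl_group \<Delta> \<longleftrightarrow> (\<exists>as. set as \<subseteq> S \<and> w = refl_prod as)"
proof
  assume "w \<in> weyl_group \<Delta>"
  then show "\<exists>as. set as \<subseteq> S \<and> w = refl_prod as"
  proof induction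
    case weyl_id
    show ?case by (intro exI[of _ "[]"]) simp
  next
    case (weyl_step a w)
    then obtain as bs where "set as \<subseteq> S" "w = refl_prod as" "set bs \<subseteq> S" "reflection a = refl_prod bs"
      using reflection_eq_refl_prod by metis
    then show ?case by (intro exI[of _ "bs @ as"]) simp
  qed
next
  assume "\<exists>as. set as \<subseteq> S \<and> w = refl_prod as"
  then obtain as where as: "set as \<subseteq> S" "w = refl_prod as" by blast
  have "refl_prod as \<in> weyl_group \<Delta>" using as(1)
    by (induction as)
      (auto simp del: o_apply simp: simple_root intro: weyl_group.intros)
  then show "w \<in> weyl_group \<Delta>" using as by simp
qed

section \<open>The height of a coroot\<close>

definition coheight :: "'a \<Rightarrow> real" where
  "coheight x = half_sum_positive \<Delta> S \<bullet> coroot x"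

text \<open>The reflection in \<open>a\<close> permutes the positive roots other than \<open>a\<close> and changes the sign of their
  products with \<open>a\<close>, so in twice the half sum only \<open>a\<close> itself contributes.\<close>

lemma half_sum_inner_simple:
  assumes "a \<in> S"
  shows "half_sum_positive \<Delta> S \<bullet> a = (a \<bullet> a) / 2"
proof -
  let ?Q = "Pos - {a}"
  have maps: "reflection a b \<in> ?Q" if "b \<in> ?Q" for b
  proof -
    have "reflection a b \<noteq> a"
    proof
      assume "reflection a b = a"
      then have "b = - a" using reflection_involution[of a b] by (simp add: reflection_self)
      then have "coord b a = - 1" using assms by (simp add: coord_minus coord_simple)
      then show False using that assms by (force simp: Pos_iff)
    qed
    then show ?thesis using that reflection_simple_Pos assms by auto
  qed
  have "(\<Sum>b\<in>?Q. b \<bullet> a) = (\<Sum>b\<in>?Q. reflection a b \<bullet> a)"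
    by (rule sum.reindex_bij_witness[of _ "reflection a" "reflection a"]) (use maps in auto)
  also have "\<dots> = (\<Sum>b\<in>?Q. - (b \<bullet> a))"
    using root_inner_pos[OF simple_root[OF assms]]
    by (intro sum.cong) (simp_all add: reflection_def inner_diff_left)
  finally have "(\<Sum>b\<in>?Q. b \<bullet> a) = 0" by (simp add: sum_negf)
  moreover have "(\<Sum>b\<in>Pos. b \<bullet> a) = a \<bullet> a + (\<Sum>b\<in>?Q. b \<bullet> a)"
    using finite_Pos simple_Pos[OF assms] by (simp add: sum.remove)
  ultimately show ?thesis by (simp add: half_sum_positive_def inner_sum_left)
qed

lemma coheight_eq_sum: "coheight x = (\<Sum>a\<in>S. coord x a * (a \<bullet> a) / (x \<bullet> x))"
proof -
  have "coheight x = 2 / (x \<bullet> x) * (x \<bullet> half_sum_positive \<Delta> S)"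
    by (simp add: coheight_def coroot_def inner_commute)
  also have "x \<bullet> half_sum_positive \<Delta> S = (\<Sum>a\<in>S. coord x a * ((a \<bullet> a) / 2))"
    by (subst coord_expand_inner)
      (auto intro!: sum.cong simp: inner_commute[of _ "half_sum_positive \<Delta> S"] half_sum_inner_simple)
  finally show ?thesis by (simp add: sum_distrib_left sum_divide_distrib field_simps)
qed

lemma coheight_minus: "coheight (- x) = - coheight x"
  by (simp add: coheight_def coroot_def)

lemma coheight_reflection:
  assumes "a \<in> S"
  shows "coheight (reflection a x) = coheight x - 2 * (x \<bullet> a) / (x \<bullet> x)"
  using root_inner_pos[OF simple_root[OF assms]]
  by (simp add: coheight_def coroot_def reflection_inner)
    (simp add: reflection_def inner_diff_right half_sum_inner_simple[OF assms]
      diff_divide_distrib right_diff_distrib)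

lemma coheight_Pos_ge_1:
  assumes "b \<in> Pos"
  shows "1 \<le> coheight b"
proof -
  have nonneg: "0 \<le> coord b a * (a \<bullet> a) / (b \<bullet> b)" if "a \<in> S" for a
    using assms that by (auto simp: Pos_iff)
  have "coheight b \<noteq> 0"
  proof
    assume "coheight b = 0"
    then have "\<forall>a\<in>S. coord b a * (a \<bullet> a) / (b \<bullet> b) = 0"
      using sum_nonneg_eq_0_iff[OF finite_S, of "\<lambda>a. coord b a * (a \<bullet> a) / (b \<bullet> b)"] nonneg
      unfolding coheight_eq_sum by blast
    then have "\<forall>a\<in>S. coord b a = 0"
      using root_inner_pos simple_root Pos_root[OF assms] zero_not_root by fastforce
    then have "b = 0" using coord_expand[of b] by simp
    then show False using assms Pos_root zero_not_root by blast
  qed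
  moreover have "0 \<le> coheight b" using nonneg by (simp add: coheight_eq_sum sum_nonneg)
  moreover have "coheight b \<in> \<int>"
    unfolding coheight_eq_sum using coroot_coord_int[OF assms] by (intro Ints_sum) auto
  ultimately show ?thesis by (auto elim!: Ints_cases)
qed

section \<open>Long roots and words of minimal length\<close>

definition long_root :: "'a \<Rightarrow> bool" where
  "long_root x \<longleftrightarrow> x \<in> \<Delta> \<and> (\<forall>a\<in>\<Delta>. norm a \<le> norm x)"

lemma long_root_reflection: "long_root x \<Longrightarrow> a \<in> \<Delta> \<Longrightarrow> long_root (reflection a x)"
  by (simp add: long_root_def reflection_root reflection_norm)

lemma long_root_inner_eq: "long_root x \<Longrightarrow> long_root y \<Longrightarrow> x \<bullet> x = y \<bullet> y"
  by (metis long_root_def order_antisym dot_square_norm)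

text \<open>Since \<open>a\<close> is at most as long as \<open>x\<close>, a pairing of 2 or more gives
  \<open>(x - a, x - a) \<le> (a, a) - (x, x) \<le> 0\<close>.\<close>

lemma long_root_pairing_ge_2:
  assumes "long_root x" "a \<in> \<Delta>" "2 \<le> 2 * (x \<bullet> a) / (x \<bullet> x)"
  shows "a = x"
proof -
  have "x \<bullet> x > 0" using assms(1) root_inner_pos by (auto simp: long_root_def)
  then have "2 * (x \<bullet> x) \<le> 2 * (x \<bullet> a)" using assms(3) by (simp add: field_simps)
  moreover have "a \<bullet> a \<le> x \<bullet> x"
    using assms(1,2) by (simp add: long_root_def norm_le)
  ultimately have "(x - a) \<bullet> (x - a) \<le> 0"
    by (simp add: inner_diff_left inner_diff_right inner_commute)
  then have "(x - a) \<bullet> (x - a) = 0" using inner_ge_zero[of "x - a"] by linarith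
  then show ?thesis by simp
qed

lemma long_root_pairing_cases:
  assumes "long_root x" "a \<in> \<Delta>"
  shows "a = x \<or> a = - x \<or> 2 * (x \<bullet> a) / (x \<bullet> x) \<in> {-1, 0, 1}"
proof -
  have "2 * (x \<bullet> a) / (x \<bullet> x) \<in> \<int>"
    using cartan_int[of x a] assms by (auto simp: long_root_def inner_commute)
  then obtain k where k: "2 * (x \<bullet> a) / (x \<bullet> x) = of_int k" by (auto elim: Ints_cases)
  consider "2 \<le> k" | "k \<le> -2" | "k \<in> {-1, 0, 1}" by force
  then show ?thesis
  proof cases
    case 1
    then show ?thesis using long_root_pairing_ge_2[OF assms] k by simp
  next
    case 2
    then have "of_int k \<le> (-2::real)" by linarith
    then have "- a = x"
      using long_root_pairing_ge_2[OF assms(1) minus_root[OF assms(2)]] k by simp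
    then show ?thesis by auto
  qed (use k in auto)
qed

text \<open>Only for \<open>a = x\<close> and \<open>a = - x\<close> does the coheight change by more than 1; then \<open>x\<close> goes to
  \<open>- x\<close>, and the absolute value hides the change.\<close>

lemma abs_coheight_reflection_ge:
  assumes "long_root x" "a \<in> S"
  shows "\<bar>coheight x\<bar> - 1 \<le> \<bar>coheight (reflection a x)\<bar>"
proof -
  consider "a = x \<or> a = - x" | "2 * (x \<bullet> a) / (x \<bullet> x) \<in> {-1, 0, 1}"
    using long_root_pairing_cases[OF assms(1) simple_root[OF assms(2)]] by blast
  then show ?thesis
  proof cases
    case 1
    then have "reflection a x = - x"
      using reflection_self[of x] reflection_minus_root[of x] by metis
    then show ?thesis by (simp add: coheight_minus)
  next
    case 2
    then show ?thesis unfolding coheight_reflection[OF assms(2)] by auto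
  qed
qed

lemma refl_prod_height_bound:
  assumes "set as \<subseteq> S" "long_root x"
  shows "\<bar>coheight x\<bar> - \<bar>coheight (refl_prod as x)\<bar> \<le> real (length as)"
  using assms
proof (induction as arbitrary: x rule: rev_induct)
  case (snoc a as)
  then show ?case
    using abs_coheight_reflection_ge[of x a] snoc.IH[of "reflection a x"]
      long_root_reflection simple_root by force
qed simp

definition long_pos :: "'a \<Rightarrow> bool" where
  "long_pos x \<longleftrightarrow> long_root x \<and> x \<in> Pos"

lemma coheight_mono:
  assumes "long_pos x" "long_pos y" "root_ge S x y"
  shows "coheight y \<le> coheight x"
proof -
  have "x \<bullet> x = y \<bullet> y" using long_root_inner_eq assms(1,2) by (auto simp: long_pos_def)
  moreover have "(\<Sum>a\<in>S. coord y a * (a \<bullet> a) / (y \<bullet> y)) \<le> (\<Sum>a\<in>S. coord x a * (a \<bullet> a) / (y \<bullet> y))"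
    using assms(3) by (intro sum_mono divide_right_mono mult_right_mono) (auto simp: root_ge_iff)
  ultimately show ?thesis by (simp add: coheight_eq_sum)
qed

text \<open>As \<open>x\<close> and \<open>y\<close> have the same length, \<open>(x, x - y) > 0\<close>, and some simple root in the expansion
  of \<open>x - y\<close> must contribute to this product.\<close>

lemma descent_direction:
  assumes "long_pos x" "long_pos y" "root_ge S x y" "x \<noteq> y"
  shows "\<exists>a\<in>S. coord y a < coord x a \<and> 0 < x \<bullet> a"
proof -
  have eq: "x \<bullet> x = y \<bullet> y" using long_root_inner_eq assms by (auto simp: long_pos_def)
  have "0 < (x - y) \<bullet> (x - y)" using assms(4) by simp
  then have "0 < (x - y) \<bullet> x"
    using eq by (simp add: inner_diff_left inner_diff_right inner_commute)
  moreover have "\<forall>a\<in>S. 0 \<le> coord (x - y) a" using assms(3) by (simp add: root_ge_iff coord_diff)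
  ultimately show ?thesis using inner_pos_simple[of "x - y" x] by (auto simp: coord_diff)
qed

text \<open>The order is preserved because the coroot of \<open>x\<close> loses the simple coroot of \<open>a\<close> once, and
  by integrality this simple coroot occurs at least once in the difference of the coroots.\<close>

lemma descent_step:
  assumes "long_pos x" "long_pos y" "root_ge S x y"
    and a: "a \<in> S" "coord y a < coord x a" "0 < x \<bullet> a"
  shows "2 * (x \<bullet> a) / (x \<bullet> x) = 1" (is ?pairing)
    and "long_pos (reflection a x)" (is ?long)
    and "root_ge S (reflection a x) y" (is ?ge)
    and "coheight (reflection a x) = coheight x - 1" (is ?height)
proof -
  have lx: "long_root x" "x \<in> Pos" and ly: "long_root y" "y \<in> Pos"
    using assms by (auto simp: long_pos_def)
  have pos: "x \<bullet> x > 0" "a \<bullet> a > 0"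
    using root_inner_pos Pos_root lx simple_root a(1) by auto
  have "x \<noteq> a"
  proof
    assume "x = a"
    \<comment> \<open>then \<open>y\<close> would have integral coordinates between 0 and those of \<open>a\<close>, and less than 1 at \<open>a\<close>\<close>
    have "coord y c = 0" if "c \<in> S" for c
    proof -
      have "0 \<le> coord y c" using ly that by (auto simp: Pos_iff)
      moreover have "coord y c < 1"
        using a assms(3) that \<open>x = a\<close> coord_simple[of a c]
        by (cases "c = a") (fastforce simp: root_ge_iff)+
      moreover have "coord y c \<in> \<int>" using coord_root_int Pos_root ly(2) that by blast
      ultimately show ?thesis by (auto elim!: Ints_cases)
    qed
    then have "y = 0" using coord_expand[of y] by simp
    then show False using ly Pos_root zero_not_root by blast
  qed
  moreover have "a \<noteq> - x"
    using a(3) pos by (metis inner_minus_right neg_0_less_iff_less less_asym)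
  ultimately have "2 * (x \<bullet> a) / (x \<bullet> x) \<in> {-1, 0, 1}"
    using long_root_pairing_cases[OF lx(1) simple_root[OF a(1)]] by blast
  moreover have "0 < 2 * (x \<bullet> a) / (x \<bullet> x)" using a(3) pos by simp
  ultimately show pairing: ?pairing by auto
  show ?long
    using lx long_root_reflection simple_root a(1) reflection_simple_Pos \<open>x \<noteq> a\<close>
    by (simp add: long_pos_def)
  show ?height unfolding coheight_reflection[OF a(1)] pairing ..
  let ?m = "\<lambda>z. coord z a * (a \<bullet> a) / (x \<bullet> x)"
  have "y \<bullet> y = x \<bullet> x" using long_root_inner_eq lx ly by blast
  then have "?m x - ?m y \<in> \<int>"
    using coroot_coord_int[OF lx(2) a(1)] coroot_coord_int[OF ly(2) a(1)] by (intro Ints_diff) auto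
  moreover have "0 < ?m x - ?m y"
    using a(2) pos by (simp add: divide_strict_right_mono)
  ultimately have "1 \<le> ?m x - ?m y" by (auto elim!: Ints_cases)
  then have "1 \<le> (coord x a - coord y a) * (a \<bullet> a) / (x \<bullet> x)"
    by (simp add: left_diff_distrib diff_divide_distrib)
  then have "x \<bullet> x \<le> (coord x a - coord y a) * (a \<bullet> a)"
    using pos by (simp add: pos_le_divide_eq)
  moreover have "x \<bullet> x = 2 * (x \<bullet> a)" using pairing pos by (simp add: field_simps)
  ultimately have "2 * (x \<bullet> a) / (a \<bullet> a) \<le> coord x a - coord y a"
    using pos by (simp add: field_simps)
  then show ?ge
    using assms(3) a(1) by (auto simp: root_ge_iff coord_reflection)
qed

lemma shortest_word_exists:
  assumes "long_pos x" "long_pos y" "root_ge S x y"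
  shows "\<exists>as. set as \<subseteq> S \<and> refl_prod as x = y \<and> real (length as) = coheight x - coheight y"
proof -
  have "\<exists>as. set as \<subseteq> S \<and> refl_prod as x = y \<and> real (length as) = coheight x - coheight y"
    if "long_pos x" "root_ge S x y" "coheight x - coheight y \<le> real n" for n x
    using that
  proof (induction n arbitrary: x)
    case (0 x)
    have "x = y"
    proof (rule ccontr)
      assume "x \<noteq> y"
      then obtain a where a: "a \<in> S" "coord y a < coord x a" "0 < x \<bullet> a"
        using descent_direction assms(2) 0 by blast
      note d = descent_step[OF 0(1) assms(2) 0(2) a]
      show False using coheight_mono[OF d(2) assms(2) d(3)] d(4) 0(3) by simp
    qed
    then show ?case by (intro exI[of _ "[]"]) simp
  next
    case (Suc n x)
    show ?case
    proof (cases "x = y")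
      case True
      then show ?thesis by (intro exI[of _ "[]"]) simp
    next
      case False
      then obtain a where a: "a \<in> S" "coord y a < coord x a" "0 < x \<bullet> a"
        using descent_direction assms(2) Suc by blast
      note d = descent_step[OF Suc.prems(1) assms(2) Suc.prems(2) a]
      obtain as where "set as \<subseteq> S" "refl_prod as (reflection a x) = y"
        "real (length as) = coheight (reflection a x) - coheight y"
        using Suc.IH[OF d(2,3)] d(4) Suc.prems(3) by auto
      then show ?thesis using a(1) d(4) by (intro exI[of _ "as @ [a]"]) auto
    qed
  qed
  then show ?thesis using assms real_arch_simple by blast
qed

text \<open>In a word that attains the height bound, the letter applied first must lower the coheight by
  exactly 1, which in particular keeps the root positive.\<close>

lemma shortest_word_snoc:
  assumes "long_pos x" "long_pos y" "set (as @ [a]) \<subseteq> S" "refl_prod (as @ [a]) x = y"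
    and len: "real (length (as @ [a])) = coheight x - coheight y"
  shows "long_pos (reflection a x)" "0 < x \<bullet> a"
    and "real (length as) = coheight (reflection a x) - coheight y"
proof -
  have lx: "long_root x" "x \<in> Pos" and a: "a \<in> S" and as: "set as \<subseteq> S"
    using assms by (auto simp: long_pos_def)
  let ?r = "reflection a x"
  have hx: "1 \<le> coheight x" and hy: "1 \<le> coheight y"
    using assms coheight_Pos_ge_1 by (auto simp: long_pos_def)
  have "\<bar>coheight ?r\<bar> - \<bar>coheight y\<bar> \<le> real (length as)"
    using refl_prod_height_bound[OF as, of ?r] long_root_reflection lx(1) simple_root[OF a] assms(4)
    by auto
  then have le: "\<bar>coheight ?r\<bar> \<le> coheight x - 1" using len hy by simp
  have "x \<noteq> a"
  proof
    assume "x = a"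
    then have "coheight ?r = - coheight x" by (simp add: reflection_self coheight_minus)
    then show False using le by simp
  qed
  then have r: "?r \<in> Pos" using reflection_simple_Pos lx a by blast
  then show "long_pos ?r" using long_root_reflection lx simple_root a by (simp add: long_pos_def)
  have "coheight x - 1 \<le> coheight ?r"
    using abs_coheight_reflection_ge[OF lx(1) a] coheight_Pos_ge_1[OF r] hx by simp
  then have eq: "coheight ?r = coheight x - 1" using le by simp
  then show "real (length as) = coheight ?r - coheight y" using len by simp
  have "0 < 2 * (x \<bullet> a) / (x \<bullet> x)" using eq coheight_reflection[OF a, of x] by linarith
  then show "0 < x \<bullet> a"
    using root_inner_pos[OF Pos_root[OF lx(2)]] by (simp add: zero_less_divide_iff)
qed

lemma root_ge_of_shortest_word:
  assumes "long_pos x" "long_pos y" "set as \<subseteq> S" "refl_prod as x = y"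
    and "real (length as) = coheight x - coheight y"
  shows "root_ge S x y"
  using assms
proof (induction as arbitrary: x rule: rev_induct)
  case Nil
  then show ?case by (simp add: root_ge_iff)
next
  case (snoc a as)
  note s = shortest_word_snoc[OF snoc.prems]
  have a: "a \<in> S" using snoc.prems by simp
  have "root_ge S (reflection a x) y"
    using snoc.IH[OF s(1) snoc.prems(2)] snoc.prems s(3) by simp
  moreover have "0 < 2 * (x \<bullet> a) / (a \<bullet> a)" using s(2) root_inner_pos[OF simple_root[OF a]] by simp
  ultimately show ?case
    using a by (fastforce simp: root_ge_iff coord_reflection split: if_splits)
qed

lemma add_root_if_inner_neg:
  assumes "a \<in> \<Delta>" "b \<in> \<Delta>" "a + b \<noteq> 0" "a \<bullet> b < 0"
  shows "a + b \<in> \<Delta>"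
proof -
  have *: "a + b \<in> \<Delta>"
    if "a \<in> \<Delta>" "b \<in> \<Delta>" "a + b \<noteq> 0" "a \<bullet> b < 0" "b \<bullet> b \<le> a \<bullet> a" for a b
  proof -
    \<comment> \<open>against the longer root the pairing is \<open>-1\<close>\<close>
    have pos: "0 < a \<bullet> a" using root_inner_pos that by blast
    have "2 * (b \<bullet> a) / (a \<bullet> a) \<in> \<int>" using cartan_int that by blast
    moreover have "2 * (b \<bullet> a) / (a \<bullet> a) < 0"
      using that pos by (simp add: inner_commute divide_less_0_iff)
    moreover have "-2 < 2 * (b \<bullet> a) / (a \<bullet> a)"
    proof -
      have "0 < (a + b) \<bullet> (a + b)" using that by simp
      then have "0 < a \<bullet> a + 2 * (b \<bullet> a) + b \<bullet> b"
        by (simp add: inner_add_left inner_add_right inner_commute)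
      then show ?thesis using that(5) pos by (simp add: field_simps)
    qed
    moreover have "t = -1" if "t \<in> \<int>" "t < 0" "-2 < t" for t :: real
    proof -
      obtain k where "t = of_int k" using \<open>t \<in> \<int>\<close> by (rule Ints_cases)
      then have "k < 0" "-2 < k" using that(2,3) by linarith+
      then show ?thesis using \<open>t = of_int k\<close> by simp
    qed
    ultimately have "2 * (b \<bullet> a) / (a \<bullet> a) = -1" by blast
    then have "reflection a b = a + b" by (simp add: reflection_def)
    then show ?thesis using reflection_root[OF that(1,2)] by simp
  qed
  show ?thesis
    using *[of a b] *[of b a] assms by (cases "b \<bullet> b \<le> a \<bullet> a") (auto simp: inner_commute add.commute)
qed

text \<open>Two different simple roots along which one can descend from \<open>x\<close> towards \<open>y\<close> are orthogonal:
  otherwise their sum is a root with pairing 2 with \<open>x\<close>, hence equal to \<open>x\<close>, and below it there is no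
  positive root that lacks both of them.\<close>

lemma descent_directions_orthogonal:
  assumes "long_pos x" "long_pos y" "root_ge S x y"
    and a: "a \<in> S" "coord y a < coord x a" "0 < x \<bullet> a"
    and b: "b \<in> S" "coord y b < coord x b" "0 < x \<bullet> b"
    and "a \<noteq> b"
  shows "a \<bullet> b = 0"
proof (rule ccontr)
  assume "a \<bullet> b \<noteq> 0"
  then have neg: "a \<bullet> b < 0" using simple_inner_nonpos[of a b] a b assms(10) by simp
  have ca: "coord (a + b) c = (if c = a \<or> c = b then 1 else 0)" for c
    using a b assms(10) by (simp add: coord_add coord_simple)
  have "a + b \<noteq> 0"
  proof
    assume "a + b = 0"
    then show False using ca[of a] coord_scaleR[of 0 0 a] by simp
  qed
  then have "a + b \<in> \<Delta>" using add_root_if_inner_neg simple_root a b neg by blast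
  moreover have "2 \<le> 2 * (x \<bullet> (a + b)) / (x \<bullet> x)"
    using descent_step(1)[OF assms(1-3) a] descent_step(1)[OF assms(1-3) b]
    by (simp add: inner_add_right distrib_left add_divide_distrib)
  ultimately have x: "x = a + b"
    using long_root_pairing_ge_2 assms(1) by (auto simp: long_pos_def)
  have y: "y \<in> Pos" using assms(2) by (simp add: long_pos_def)
  have "coord y c = 0" if "c \<in> S" for c
  proof -
    have "0 \<le> coord y c" using y that by (auto simp: Pos_iff)
    moreover have "coord y c < 1"
    proof (cases "c = a \<or> c = b")
      case True
      then show ?thesis using a(2) b(2) x ca[of c] by auto
    next
      case False
      have "coord y c \<le> coord x c" using assms(3) that by (simp add: root_ge_iff)
      then show ?thesis using False x ca[of c] by simp
    qed
    moreover have "coord y c \<in> \<int>" using coord_root_int Pos_root y that by blast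
    ultimately show ?thesis by (auto elim!: Ints_cases)
  qed
  then have "y = 0" using coord_expand[of y] by simp
  then show False using y Pos_root zero_not_root by blast
qed

text \<open>If the two words start with different reflections, in \<open>a\<close> and \<open>b\<close>, these are orthogonal, and a
  shortest word \<open>cs\<close> from the root reached by both of them completes a diamond: by the
  induction hypothesis \<open>cs @ [b]\<close> can replace the rest of the first word, and \<open>cs @ [a]\<close> the rest of
  the second one.\<close>

lemma shortest_word_unique:
  assumes "long_pos x" "long_pos y"
    and "set as \<subseteq> S" "refl_prod as x = y" "real (length as) = coheight x - coheight y"
    and "set bs \<subseteq> S" "refl_prod bs x = y" "real (length bs) = coheight x - coheight y"
  shows "refl_prod as = refl_prod bs"
  using assms
proof (induction as arbitrary: x bs rule: length_induct)
  case (1 as x bs)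
  note prems = "1.prems"
  have len: "length as = length bs" using prems by simp
  show ?case
  proof (cases as rule: rev_cases)
    case Nil
    then show ?thesis using len by simp
  next
    case as: (snoc as' a)
    then obtain bs' b where bs: "bs = bs' @ [b]" using len by (cases bs rule: rev_cases) auto
    have IH: "refl_prod cs = refl_prod ds"
      if "length cs = length as'" "long_pos z" "set cs \<subseteq> S" "refl_prod cs z = y"
        "real (length cs) = coheight z - coheight y"
        "set ds \<subseteq> S" "refl_prod ds z = y" "real (length ds) = coheight z - coheight y" for cs ds z
      using "1.IH" that as prems(2) by auto
    have S: "set as' \<subseteq> S" "a \<in> S" "set bs' \<subseteq> S" "b \<in> S" using prems as bs by auto
    have len': "length bs' = length as'" using len as bs by simp
    have ya: "refl_prod as' (reflection a x) = y" and yb: "refl_prod bs' (reflection b x) = y"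
      using prems as bs by auto
    note sa = shortest_word_snoc[OF prems(1,2) prems(3-5)[unfolded as]]
    note sb = shortest_word_snoc[OF prems(1,2) prems(6-8)[unfolded bs]]
    show ?thesis
    proof (cases "a = b")
      case True
      have "refl_prod as' = refl_prod bs'"
        using IH[OF refl sa(1) S(1) ya sa(3) S(3)] yb sb(3) True by simp
      then show ?thesis using as bs True by simp
    next
      case False
      have ge: "root_ge S x y" using root_ge_of_shortest_word prems by blast
      have "coord y c < coord x c"
        if "c \<in> S" "0 < x \<bullet> c" "root_ge S (reflection c x) y" for c
      proof -
        have "0 < 2 * (x \<bullet> c) / (c \<bullet> c)" using that root_inner_pos[OF simple_root] by simp
        then show ?thesis using that by (force simp: root_ge_iff coord_reflection)
      qed
      then have ca: "coord y a < coord x a" and cb: "coord y b < coord x b"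
        using S sa(2) sb(2) root_ge_of_shortest_word[OF sa(1) prems(2) S(1) ya sa(3)]
          root_ge_of_shortest_word[OF sb(1) prems(2) S(3) yb sb(3)] by auto
      have orth: "a \<bullet> b = 0"
        using descent_directions_orthogonal[OF prems(1,2) ge S(2) ca sa(2) S(4) cb sb(2) False] .
      note da = descent_step[OF prems(1,2) ge S(2) ca sa(2)]
      note db = descent_step[OF prems(1,2) ge S(4) cb sb(2)]
      have "coord y b < coord (reflection a x) b" "0 < reflection a x \<bullet> b"
        using cb sb(2) False S orth
        by (auto simp: coord_reflection) (simp add: reflection_def inner_diff_left)
      note dab = descent_step[OF da(2) prems(2) da(3) S(4) this]
      have comm: "reflection b (reflection a x) = reflection a (reflection b x)"
        using fun_cong[OF reflection_commute[OF orth], of x] by simp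
      obtain cs where cs: "set cs \<subseteq> S" "refl_prod cs (reflection b (reflection a x)) = y"
        "real (length cs) = coheight (reflection b (reflection a x)) - coheight y"
        using shortest_word_exists[OF dab(2) prems(2) dab(3)] by blast
      have "refl_prod as' = refl_prod (cs @ [b])"
        by (rule IH[OF refl sa(1) S(1) ya sa(3)]) (use cs S dab(4) in auto)
      moreover have "refl_prod bs' = refl_prod (cs @ [a])"
        by (rule IH[OF len' sb(1) S(3) yb sb(3)]) (use cs S dab(4) da(4) db(4) comm in auto)
      ultimately show ?thesis
        using as bs reflection_commute[OF orth] by (simp add: comp_assoc)
    qed
  qed
qed

lemma weyl_length_le:
  assumes "set as \<subseteq> S"
  shows "weyl_length S (refl_prod as) \<le> length as"
  unfolding weyl_length_def refl_prod_def by (rule Least_le) (use assms in blast)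

lemma weyl_length_attained:
  assumes "w \<in> weyl_group \<Delta>"
  obtains as where "set as \<subseteq> S" "w = refl_prod as" "length as = weyl_length S w"
proof -
  have "\<exists>as. length as = weyl_length S w \<and> set as \<subseteq> S \<and> w = foldr (\<lambda>a f. reflection a \<circ> f) as id"
    unfolding weyl_length_def
    by (rule LeastI_ex) (use assms in \<open>unfold weyl_group_iff refl_prod_def, blast\<close>)
  then show ?thesis using that by (auto simp: refl_prod_def)
qed

lemma shortest_elements:
  assumes "long_pos x" "long_pos y" "root_ge S x y"
  obtains u where
    "\<And>w. is_arg_min (weyl_length S) (\<lambda>v. v \<in> weyl_group \<Delta> \<and> v x = y) w \<longleftrightarrow> w = u"
    "real (weyl_length S u) = coheight x - coheight y"
proof -
  have h: "1 \<le> coheight x" "1 \<le> coheight y"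
    using coheight_Pos_ge_1 assms by (auto simp: long_pos_def)
  have lower: "coheight x - coheight y \<le> real (weyl_length S v)"
    if "v \<in> weyl_group \<Delta>" "v x = y" for v
  proof -
    obtain as where "set as \<subseteq> S" "v = refl_prod as" "length as = weyl_length S v"
      using weyl_length_attained \<open>v \<in> weyl_group \<Delta>\<close> by blast
    then show ?thesis
      using refl_prod_height_bound[of as x] assms(1) that(2) h by (auto simp: long_pos_def)
  qed
  obtain cs where cs: "set cs \<subseteq> S" "refl_prod cs x = y" "real (length cs) = coheight x - coheight y"
    using shortest_word_exists[OF assms] by blast
  define u where "u = refl_prod cs"
  have u: "u \<in> weyl_group \<Delta>" "u x = y" using cs by (auto simp: u_def weyl_group_iff)
  have lu: "real (weyl_length S u) = coheight x - coheight y"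
    using lower[OF u] weyl_length_le[OF cs(1)] cs(3) by (simp add: u_def)
  have "is_arg_min (weyl_length S) (\<lambda>v. v \<in> weyl_group \<Delta> \<and> v x = y) w \<longleftrightarrow> w = u" for w
  proof
    assume w: "is_arg_min (weyl_length S) (\<lambda>v. v \<in> weyl_group \<Delta> \<and> v x = y) w"
    then have "w \<in> weyl_group \<Delta>" "w x = y" and "weyl_length S w \<le> weyl_length S u"
      using u by (auto simp: is_arg_min_def not_less)
    then have lw: "real (weyl_length S w) = coheight x - coheight y"
      using lower[of w] lu by linarith
    obtain as where "set as \<subseteq> S" "w = refl_prod as" "length as = weyl_length S w"
      using weyl_length_attained \<open>w \<in> weyl_group \<Delta>\<close> by blast
    then show "w = u"
      using shortest_word_unique[OF assms(1,2) _ _ _ cs] lw \<open>w x = y\<close> by (simp add: u_def)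
  next
    assume "w = u"
    then show "is_arg_min (weyl_length S) (\<lambda>v. v \<in> weyl_group \<Delta> \<and> v x = y) w"
      using u lu lower by (force simp: is_arg_min_def)
  qed
  then show thesis using that lu by blast
qed

end

theorem proposition1p2:
  fixes \<Delta> S :: "'a::euclidean_space set" and \<gamma> \<mu> :: 'a
  assumes "crystallographic_root_system \<Delta>"
    and "irreducible_system \<Delta>"
    and "simple_system \<Delta> S"
    and "\<gamma> \<in> long_positive_roots \<Delta> S"
    and "\<mu> \<in> long_positive_roots \<Delta> S"
    and "root_ge S \<gamma> \<mu>"
  shows "(\<exists>!w. is_arg_min (weyl_length S) (\<lambda>v. v \<in> weyl_group \<Delta> \<and> v \<gamma> = \<mu>) w) \<and>
    (\<forall>w. is_arg_min (weyl_length S) (\<lambda>v. v \<in> weyl_group \<Delta> \<and> v \<gamma> = \<mu>) w \<longrightarrow>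
       real (weyl_length S w) =
         half_sum_positive \<Delta> S \<bullet> coroot \<gamma> - half_sum_positive \<Delta> S \<bullet> coroot \<mu>)"
proof -
  interpret based_root_system \<Delta> S
    using assms(1,3) by unfold_locales
  have "long_pos \<gamma>" "long_pos \<mu>"
    using assms(4,5)
    by (auto simp: long_positive_roots_def long_pos_def long_root_def Pos_iff)
  then obtain u where
    "\<And>w. is_arg_min (weyl_length S) (\<lambda>v. v \<in> weyl_group \<Delta> \<and> v \<gamma> = \<mu>) w \<longleftrightarrow> w = u"
    "real (weyl_length S u) = coheight \<gamma> - coheight \<mu>"
    using shortest_elements[OF _ _ assms(6)] by blast
  then show ?thesis by (simp add: coheight_def)
qed

end
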